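(* Let $(t_n)_{n\in\mathbb N_0}$ be a sequence of natural numbers with $t_0>0$ and $t_n>\sum_{k=0}^{n-1}t_k$ for every $n\in\mathbb N$. Then the generalized Bratteli diagram $B(t_n)$ has no probability tail invariant measure on its path space.
   Context: The diagram $B(t_n)$: vertex sets $V_n=\mathbb Z$ for every $n\in\mathbb N_0$; each $i\in V_n$ has exactly two outgoing edges in $E_n$, one with range $i-t_n\in V_{n+1}$ and one with range $i+t_n\in V_{n+1}$ (so each $j\in V_{n+1}$ has exactly two incoming edges, with sources $j\pm t_n\in V_n$). The path space is the set of infinite sequences $(x_n)_{n\ge0}$ with $x_n\in E_n$ and $r(x_n)=s(x_{n+1})$ (here $s,r$ denote source and range), with the topology generated by the cylinder sets $[\overline e]$ of infinite paths beginning with a finite path $\overline e$ starting in $V_0$. A measure (non-atomic positive Borel) $\mu$ is tail invariant if $\mu([\overline e])=\mu([\overline e'])$ whenever $\overline e,\overline e'$ are finite paths from $V_0$ ending at the same vertex. *)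

theory Defs
  imports "HOL-Probability.Probability"
begin

text \<open>
  The generalized Bratteli diagram given by a sequence \<open>t\<close>. The vertex sets are disjoint copies
  of the integers, so the vertex \<open>i\<close> of level \<open>n\<close> is the pair \<open>(n, i)\<close>. An edge of level \<open>n\<close> is
  \<open>(i, b)\<close>, where \<open>i\<close> is the integer label of its source and \<open>b\<close> tells which of the two edges
  leaving that source is meant: the one going to \<open>i + t n\<close> (\<open>b = True\<close>) or the one going to
  \<open>i - t n\<close> (\<open>b = False\<close>). The level of an edge is its position in a path.
\<close>

type_synonym vertex = "nat \<times> int"
type_synonym edge = "int \<times> bool"

definition edge_source :: "nat \<Rightarrow> edge \<Rightarrow> vertex" where
  "edge_source n e = (n, fst e)"

definition edge_range :: "(nat \<Rightarrow> nat) \<Rightarrow> nat \<Rightarrow> edge \<Rightarrow> vertex" where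
  "edge_range t n e = (Suc n, if snd e then fst e + int (t n) else fst e - int (t n))"

definition path_space :: "(nat \<Rightarrow> nat) \<Rightarrow> (nat \<Rightarrow> edge) set" where
  "path_space t = {x. \<forall>n. edge_range t n (x n) = edge_source (Suc n) (x (Suc n))}"

text \<open>Finite paths start in level 0 and have at least one edge.\<close>

definition finite_path :: "(nat \<Rightarrow> nat) \<Rightarrow> edge list \<Rightarrow> bool" where
  "finite_path t es \<longleftrightarrow> es \<noteq> [] \<and>
     (\<forall>n. Suc n < length es \<longrightarrow> edge_range t n (es ! n) = edge_source (Suc n) (es ! Suc n))"

definition path_end :: "(nat \<Rightarrow> nat) \<Rightarrow> edge list \<Rightarrow> vertex" where
  "path_end t es = edge_range t (length es - 1) (last es)"

definition cylinder :: "(nat \<Rightarrow> nat) \<Rightarrow> edge list \<Rightarrow> (nat \<Rightarrow> edge) set" where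
  "cylinder t es = {x \<in> path_space t. \<forall>n < length es. x n = es ! n}"

definition path_topology :: "(nat \<Rightarrow> nat) \<Rightarrow> (nat \<Rightarrow> edge) topology" where
  "path_topology t = topology_generated_by {cylinder t es |es. finite_path t es}"

lemma topspace_path_topology: "topspace (path_topology t) = path_space t"
proof -
  have cylinder_subset: "cylinder t es \<subseteq> path_space t" for es
    by (auto simp: cylinder_def)
  have "x \<in> cylinder t [x 0] \<and> finite_path t [x 0]" if "x \<in> path_space t" for x
    using that by (simp add: cylinder_def finite_path_def)
  then show ?thesis
    unfolding path_topology_def topology_generated_by_topspace
    using cylinder_subset by blast
qed

definition path_borel :: "(nat \<Rightarrow> nat) \<Rightarrow> (nat \<Rightarrow> edge) measure" where
  "path_borel t = sigma (path_space t) {U. openin (path_topology t) U}"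

lemma space_path_borel: "space (path_borel t) = path_space t"
  and sets_path_borel:
    "sets (path_borel t) = sigma_sets (path_space t) {U. openin (path_topology t) U}"
proof -
  have "{U. openin (path_topology t) U} \<subseteq> Pow (path_space t)"
    using openin_subset[of "path_topology t"] by (auto simp: topspace_path_topology)
  then show "space (path_borel t) = path_space t"
    and "sets (path_borel t) = sigma_sets (path_space t) {U. openin (path_topology t) U}"
    by (simp_all add: path_borel_def)
qed

definition non_atomic :: "'a measure \<Rightarrow> bool" where
  "non_atomic M \<longleftrightarrow>
     (\<forall>A\<in>sets M. emeasure M A > 0 \<longrightarrow>
        (\<exists>B\<in>sets M. B \<subseteq> A \<and> 0 < emeasure M B \<and> emeasure M B < emeasure M A))"

text \<open>
  Measures on the path space are by convention non-atomic positive Borel measures. Vertices carry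
  their level, so \<open>es\<close> and \<open>es'\<close> ending at the same vertex have the same length.
\<close>

definition tail_invariant :: "(nat \<Rightarrow> nat) \<Rightarrow> (nat \<Rightarrow> edge) measure \<Rightarrow> bool" where
  "tail_invariant t M \<longleftrightarrow>
     sets M = sets (path_borel t) \<and> non_atomic M \<and>
     (\<forall>es es'. finite_path t es \<longrightarrow> finite_path t es' \<longrightarrow> path_end t es = path_end t es' \<longrightarrow>
        emeasure M (cylinder t es) = emeasure M (cylinder t es'))"

end

theory Submission
  imports Defs
begin

text \<open>
  A tail invariant probability measure gives, for each choice \<open>b'\<close> of the first \<open>n\<close> directions and
  each start vertex \<open>i\<close>, a set of the same measure as the set of all paths starting at \<open>i\<close>: replace
  the first \<open>n\<close> edges of a path by those with directions \<open>b'\<close> ending at the same vertex. Since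
  \<open>t\<close> is superincreasing, the \<open>2 ^ n\<close> signed sums of \<open>t 0, \<dots>, t (n - 1)\<close> are distinct,
  so these sets are disjoint for distinct \<open>b'\<close>. Hence the paths starting at \<open>i\<close> have measure at
  most \<open>1 / 2 ^ n\<close> for every \<open>n\<close>, that is, measure zero, and there are only countably many \<open>i\<close>.
\<close>

definition signed_sum :: "(nat \<Rightarrow> nat) \<Rightarrow> (nat \<Rightarrow> bool) \<Rightarrow> nat \<Rightarrow> int" where
  "signed_sum t b n = (\<Sum>k<n. if b k then int (t k) else - int (t k))"

lemma signed_sum_0 [simp]: "signed_sum t b 0 = 0"
  and signed_sum_Suc [simp]:
    "signed_sum t b (Suc n) = signed_sum t b n + (if b n then int (t n) else - int (t n))"
  by (simp_all add: signed_sum_def)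

lemma abs_signed_sum_le: "\<bar>signed_sum t b n\<bar> \<le> int (\<Sum>k<n. t k)"
  by (induction n) auto

lemma signed_sum_cong: "(\<And>k. k < n \<Longrightarrow> b k = b' k) \<Longrightarrow> signed_sum t b n = signed_sum t b' n"
  by (simp add: signed_sum_def)

text \<open>If the last directions differed, the two earlier sums would differ by
  \<open>2 * t n\<close>, but each has absolute value at most the sum of the earlier
  \<open>t k\<close>, which is below \<open>t n\<close>. So the last terms agree and cancel.\<close>

lemma signed_sum_inject:
  assumes superincreasing: "\<And>n. (\<Sum>k<n. t k) < t n"
    and "signed_sum t b n = signed_sum t b' n"
  shows "\<forall>k<n. b k = b' k"
  using assms(2)
proof (induction n)
  case (Suc n)
  have "b n = b' n"
    using Suc.prems superincreasing[of n] abs_signed_sum_le[of t b n] abs_signed_sum_le[of t b' n]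
    by (auto split: if_splits simp flip: of_nat_sum)
  with Suc show ?case
    by (auto simp: less_Suc_eq split: if_splits)
qed simp

definition walk :: "(nat \<Rightarrow> nat) \<Rightarrow> int \<Rightarrow> (nat \<Rightarrow> bool) \<Rightarrow> nat \<Rightarrow> edge list" where
  "walk t i b n = map (\<lambda>k. (i + signed_sum t b k, b k)) [0..<n]"

lemma length_walk [simp]: "length (walk t i b n) = n"
  and nth_walk [simp]: "k < n \<Longrightarrow> walk t i b n ! k = (i + signed_sum t b k, b k)"
  by (simp_all add: walk_def)

lemma finite_path_walk: "n > 0 \<Longrightarrow> finite_path t (walk t i b n)"
  by (auto simp: finite_path_def edge_range_def edge_source_def walk_def)

lemma path_end_walk: "n > 0 \<Longrightarrow> path_end t (walk t i b n) = (n, i + signed_sum t b n)"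
  by (cases n) (auto simp: path_end_def walk_def edge_range_def)

text \<open>The matching of ranges with sources forces every later label of a path from its first
  label and its directions.\<close>

lemma mem_cylinder_walk_iff:
  assumes "n > 0"
  shows "x \<in> cylinder t (walk t i b n) \<longleftrightarrow>
    x \<in> path_space t \<and> fst (x 0) = i \<and> (\<forall>k<n. snd (x k) = b k)" (is "?L \<longleftrightarrow> ?R")
proof
  assume ?L
  with assms show ?R
    by (auto simp: cylinder_def)
next
  assume R: ?R
  then have step: "fst (x (Suc k)) =
      (if snd (x k) then fst (x k) + int (t k) else fst (x k) - int (t k))" for k
    by (auto simp: path_space_def edge_range_def edge_source_def)
  have "k < n \<Longrightarrow> fst (x k) = i + signed_sum t b k" for k
    using R by (induction k) (auto simp: step)
  with R show ?L
    by (auto simp: cylinder_def prod_eq_iff)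
qed

lemma cylinder_in_sets_path_borel:
  "finite_path t es \<Longrightarrow> cylinder t es \<in> sets (path_borel t)"
  unfolding sets_path_borel path_topology_def
  by (intro sigma_sets.Basic CollectI topology_generated_by_Basis) auto

definition paths_from :: "(nat \<Rightarrow> nat) \<Rightarrow> int \<Rightarrow> (nat \<Rightarrow> edge) set" where
  "paths_from t i = {x \<in> path_space t. fst (x 0) = i}"

text \<open>Extensional functions record exactly the first \<open>n\<close> directions, which makes
  the index set finite and free of repetitions.\<close>

lemma paths_from_eq_UN_cylinder:
  assumes "n > 0"
  shows "paths_from t i = (\<Union>b\<in>{..<n} \<rightarrow>\<^sub>E UNIV. cylinder t (walk t i b n))"
proof -
  have "x \<in> (\<Union>b\<in>{..<n} \<rightarrow>\<^sub>E UNIV. cylinder t (walk t i b n))" if "x \<in> paths_from t i" for x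
    using that assms
    by (intro UN_I[of "restrict (\<lambda>k. snd (x k)) {..<n}"])
      (auto simp: mem_cylinder_walk_iff paths_from_def)
  then show ?thesis
    using assms by (auto simp: mem_cylinder_walk_iff paths_from_def)
qed

lemma disjoint_cylinder_walk:
  assumes "n > 0" "b \<in> {..<n} \<rightarrow>\<^sub>E UNIV" "b' \<in> {..<n} \<rightarrow>\<^sub>E UNIV" "(i, b) \<noteq> (i', b')"
  shows "cylinder t (walk t i b n) \<inter> cylinder t (walk t i' b' n) = {}"
proof -
  have "b = b'" if "\<forall>k<n. b k = b' k"
    using assms(2,3) that by (intro PiE_ext) auto
  with assms(1,4) show ?thesis
    by (auto simp: mem_cylinder_walk_iff)
qed

lemma measure_paths_from_le:
  assumes superincreasing: "\<And>n. (\<Sum>k<n. t k) < t n"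
    and "prob_space M" and inv: "tail_invariant t M" and n: "n > 0"
  shows "2 ^ n * measure M (paths_from t i) \<le> 1"
proof -
  interpret prob_space M by fact
  define D where "D = {..<n} \<rightarrow>\<^sub>E (UNIV :: bool set)"
  have "finite D"
    by (auto simp: D_def intro: finite_PiE)
  have card_D: "card D = 2 ^ n"
    by (simp add: D_def card_PiE)
  have cyl_sets: "cylinder t (walk t j b n) \<in> sets M" for j b
    using inv n by (simp add: tail_invariant_def cylinder_in_sets_path_borel finite_path_walk)
  \<comment> \<open>The start is shifted so that directions \<open>b'\<close> lead to the vertex
    that directions \<open>b\<close> reach from \<open>i\<close>; tail invariance then
    applies.\<close>
  define C where "C = (\<lambda>(b', b).
    cylinder t (walk t (i + signed_sum t b n - signed_sum t b' n) b' n))"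
  have measure_C: "measure M (C (b', b)) = measure M (cylinder t (walk t i b n))" for b b'
  proof -
    have "emeasure M (cylinder t (walk t (i + signed_sum t b n - signed_sum t b' n) b' n)) =
        emeasure M (cylinder t (walk t i b n))"
      using n by (intro inv[unfolded tail_invariant_def, THEN conjunct2, THEN conjunct2, rule_format])
        (simp_all add: finite_path_walk path_end_walk)
    then show ?thesis
      by (simp add: C_def measure_def)
  qed
  have disjoint_C: "C (b', b) \<inter> C (c', c) = {}"
    if *: "b' \<in> D" "b \<in> D" "c' \<in> D" "c \<in> D" "(b', b) \<noteq> (c', c)" for b' b c' c
  proof -
    \<comment> \<open>If \<open>b' = c'\<close> and the shifted starts coincide, then the signed
      sums of \<open>b\<close> and \<open>c\<close> are equal.\<close>
    have "b = c" if "signed_sum t b n = signed_sum t c n"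
      using *(2,4) signed_sum_inject[OF superincreasing that] unfolding D_def
      by (intro PiE_ext) auto
    with * have "(i + signed_sum t b n - signed_sum t b' n, b') \<noteq>
        (i + signed_sum t c n - signed_sum t c' n, c')"
      by auto
    with * n show ?thesis
      unfolding C_def D_def by (simp add: disjoint_cylinder_walk)
  qed
  have "disjoint_family_on C (D \<times> D)"
    unfolding disjoint_family_on_def using disjoint_C by blast
  then have "measure M (\<Union>(C ` (D \<times> D))) = (\<Sum>p\<in>D \<times> D. measure M (C p))"
    using \<open>finite D\<close> cyl_sets by (intro finite_measure_finite_Union) (auto simp: C_def)
  also have "\<dots> = (\<Sum>b'\<in>D. \<Sum>b\<in>D. measure M (cylinder t (walk t i b n)))"
    by (simp add: sum.cartesian_product' measure_C)
  \<comment> \<open>The inner sum does not depend on \<open>b'\<close>, so each of the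
    \<open>2 ^ n\<close> choices of \<open>b'\<close> contributes one full copy of this
    measure.\<close>
  also have "(\<Sum>b\<in>D. measure M (cylinder t (walk t i b n))) = measure M (paths_from t i)"
    unfolding paths_from_eq_UN_cylinder[OF n] D_def[symmetric]
    using \<open>finite D\<close> cyl_sets n
    by (intro finite_measure_finite_Union[symmetric])
      (auto simp: disjoint_family_on_def D_def disjoint_cylinder_walk)
  finally have "measure M (\<Union>(C ` (D \<times> D))) = 2 ^ n * measure M (paths_from t i)"
    by (simp add: card_D)
  then show ?thesis
    by (metis prob_le_1)
qed

theorem corollary7p8:
  fixes t :: "nat \<Rightarrow> nat"
  assumes "t 0 > 0"
    and "\<And>n. n \<ge> 1 \<Longrightarrow> t n > (\<Sum>k<n. t k)"
  shows "\<not> (\<exists>M. prob_space M \<and> tail_invariant t M)"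
proof
  assume "\<exists>M. prob_space M \<and> tail_invariant t M"
  then obtain M where "prob_space M" and inv: "tail_invariant t M"
    by blast
  interpret prob_space M by fact
  \<comment> \<open>For \<open>n = 0\<close> the sum is empty and this is
    \<open>t 0 > 0\<close>.\<close>
  have superincreasing: "(\<Sum>k<n. t k) < t n" for n
    using assms by (cases "n = 0") auto
  have sets_M: "sets M = sets (path_borel t)"
    using inv by (simp add: tail_invariant_def)
  have "paths_from t i \<in> null_sets M" for i
  proof (rule null_setsI)
    \<comment> \<open>Walks of length one suffice here: the set is a union of two cylinders.\<close>
    show "paths_from t i \<in> sets M"
      unfolding paths_from_eq_UN_cylinder[OF zero_less_one] sets_M
      by (intro sets.finite_UN) (auto intro!: finite_PiE cylinder_in_sets_path_borel finite_path_walk)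
    \<comment> \<open>The exponent is \<open>Suc n\<close> because finite paths are
      nonempty.\<close>
    have "measure M (paths_from t i) \<le> (1 / 2) ^ Suc n" for n
      using measure_paths_from_le[OF superincreasing \<open>prob_space M\<close> inv, of "Suc n" i]
      by (simp add: field_simps power_one_over)
    moreover have "(\<lambda>n. (1 / 2 :: real) ^ Suc n) \<longlonglongrightarrow> 0"
      by (intro LIMSEQ_Suc LIMSEQ_power_zero) auto
    ultimately have "measure M (paths_from t i) \<le> 0"
      by (metis LIMSEQ_le_const)
    then show "emeasure M (paths_from t i) = 0"
      by (simp add: emeasure_eq_measure measure_le_0_iff)
  qed
  then have "(\<Union>i. paths_from t i) \<in> null_sets M"
    by (intro null_sets_UN') auto
  moreover have "(\<Union>i. paths_from t i) = space M"
    using sets_eq_imp_space_eq[OF sets_M] by (auto simp: space_path_borel paths_from_def)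
  ultimately show False
    using emeasure_space_1 by (simp add: null_sets_def)
qed

end
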